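(* Let $n\ge 1$, let $\rho_1,\dots,\rho_n\in(0,+\infty)$, let $I=\prod_{i=1}^n[0,\rho_i]$, and let $\Omega$, $L_i$, $B_i$, $\zeta_i$, $K_i$, $\gamma_i$, $P_I$ and the parameters $\lambda_i,\eta_i\ge 0$ ($i=1,\dots,n$) be as described in the context. For every $i=1,\dots,n$ let $w_i:P_I\to\mathbb{R}$ be continuous with $$-\infty<\underline{w}_i:=\inf_{u\in P_I}w_i[u],\qquad \overline{w}_i:=\sup_{u\in P_I}w_i[u]<+\infty .$$ Assume that for every $i=1,\dots,n$: - $f_i\in C(\overline\Omega\times I\times[\underline{w}_i,\overline{w}_i])$ is real-valued and there exists $\tau_i\in(0,+\infty)$ such that $$0\le f_i(x,u,w)\le\tau_iu_i\quad\text{for every }(x,u,w)\in\overline\Omega\times I\times[\underline{w}_i,\overline{w}_i];$$ - $\zeta_i\in C^{2-\delta_i+\hat\mu}(\partial\Omega)$, $\zeta_i\ge 0$, $h_i:P_I\to[0,+\infty)$ is continuous and there exists $\theta_i\in(0,+\infty)$ such that $$h_i[u]\le\theta_i\|u\|\quad\text{for every }u\in P_I;$$ - the following inequality holds: $$\lambda_i\tau_i\|K_i(\hat 1)\|_\infty+\eta_i\theta_i\|\gamma_i\|_\infty<1 .$$ Then the system $$\begin{cases}L_iu_i=\lambda_if_i(x,u,w_i[u]), & x\in\Omega,\ i=1,\dots,n,\\ B_iu_i=\eta_i\zeta_i(x)h_i[u], & x\in\partial\Omega,\ i=1,\dots,n,\end{cases}$$ has at most the zero solution in $P_I$; that is,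 there is no weak solution $u\in P_I\setminus\{0\}$ of the system.
   Context: Domain. $\Omega\subset\mathbb{R}^m$, $m\ge 2$, is a bounded domain (open, connected) whose boundary $\partial\Omega$ is an $(m-1)$-dimensional $C^{2+\hat\mu}$-manifold for some $\hat\mu\in(0,1)$, with $\Omega$ lying locally on one side of $\partial\Omega$. $C^{\hat\mu}(\overline\Omega)$ is the space of $\hat\mu$-Hölder continuous real functions on $\overline\Omega$, and $C^{k+\hat\mu}(\overline\Omega)$ is the space of $g\in C^k(\overline\Omega)$ all of whose partial derivatives of order $k$ are $\hat\mu$-Hölder continuous on $\overline\Omega$. Differential operators. For $i=1,\dots,n$, $$L_iu(x)=-\sum_{j,l=1}^m a_{ijl}(x)\frac{\partial^2u}{\partial x_j\partial x_l}(x)+\sum_{j=1}^m a_{ij}(x)\frac{\partial u}{\partial x_j}(x)+a_i(x)u(x),\quad x\in\Omega,$$ where $a_{ijl},a_{ij},a_i\in C^{\hat\mu}(\overline\Omega)$, $a_i\ge 0$ on $\overline\Omega$, $a_{ijl}=a_{ilj}$ on $\overline\Omega$, and there is $\bar\mu_{i0}>0$ with $\sum_{j,l=1}^m a_{ijl}(x)\xi_j\xi_l\ge\bar\mu_{i0}\|\xi\|^2$ for all $x\in\Omega$, $\xi\in\mathbb{R}^m$. Boundary operators. For $i=1,\dots,n$, $B_iu(x)=b_i(x)u(x)+\delta_i\frac{\partial u}{\partial\nu}(x)$ for $x\in\partial\Omega$, where $\nu$ is an outward pointing, nowhere tangent vector field on $\partial\Omega$ of class $C^{1+\hat\mu}$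 (not necessarily unit), $\frac{\partial u}{\partial\nu}$ is the directional derivative of $u$ with respect to $\nu$, $b_i:\partial\Omega\to\mathbb{R}$ is of class $C^{1+\hat\mu}$, and one of the following holds: $\delta_i=0$ and $b_i\equiv 1$ (Dirichlet); or $\delta_i=1$, $b_i\equiv 0$ and $a_i\not\equiv 0$ (Neumann); or $\delta_i=1$, $b_i\ge 0$ and $b_i\not\equiv 0$ (regular oblique derivative). Also $\zeta_i\in C^{2-\delta_i+\hat\mu}(\partial\Omega)$. Solution operators (known facts fixing notation). For $g\in C^{\hat\mu}(\overline\Omega)$ the problem $L_iu=g$ in $\Omega$, $B_iu=0$ on $\partial\Omega$ has a unique classical solution $u=:K_ig\in C^{2+\hat\mu}(\overline\Omega)$. The linear operator $K_i$ extends uniquely to a continuous, linear, compact operator $K_i:C(\overline\Omega)\to C(\overline\Omega)$, which maps nonnegative functions to nonnegative functions. The function $\gamma_i\in C^{2+\hat\mu}(\overline\Omega)$ is the unique solution of $L_iu=0$ in $\Omega$, $B_iu=\zeta_i$ on $\partial\Omega$. The constant function equal to $1$ on $\overline\Omega$ is denoted $\hat 1$. Spaces and cones. $\|z\|_\infty=\max_{x\in\overline\Omega}|z(x)|$ for $z\in C(\overline\Omega)$, and $\|u\|=\max_{i=1,\dots,n}\|u_i\|_\infty$ for $u=(u_1,\dots,u_n)\in C(\overline\Omega,\mathbb{R}^n)$. $\mathbb{R}_+=[0,+\infty)$, $P=C(\overline\Omega,\mathbb{R}^n_+)$, and $P_I=\{u\in P:u(x)\in I\text{ for all }x\in\overline\Omega\}$.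 Weak solutions. The parameters $\lambda_i,\eta_i$ are nonnegative reals. A function $u\in P_I=C(\overline\Omega,I)$ is a (weak) solution of the system if $$u_i=\lambda_iK_iF_i(u)+\eta_i\,h_i[u]\,\gamma_i\quad\text{for all }i=1,\dots,n,\qquad F_i(u)(x):=f_i(x,u(x),w_i[u]).$$ *)

theory Defs
  imports "HOL-Analysis.Analysis"
begin

subsection \<open>Spaces of continuous functions\<close>

text \<open>The library space \<open>cfunspace\<close> consists of the \<^emph>\<open>extensional\<close> continuous functions on
  \<open>S\<close> (value \<open>undefined\<close> off \<open>S\<close>), so that equality of its elements is equality on \<open>S\<close>.
  Its metric is the sup-metric built on the Euclidean norm; for vector-valued functions this induces
  the same topology as \<open>maxnorm\<close> below.\<close>

abbreviation cfun :: "'a::topological_space set \<Rightarrow> ('a \<Rightarrow> 'b::metric_space) metric" where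
  "cfun S \<equiv> cfunspace (top_of_set S) euclidean_metric"

lemma mspace_cfun_iff:
  assumes "compact S"
  shows "u \<in> mspace (cfun S) \<longleftrightarrow> u \<in> extensional S \<and> continuous_on S u"
proof -
  have "bounded (u ` S)" if "continuous_on S u"
    using assms that by (simp add: compact_continuous_image compact_imp_bounded)
  then show ?thesis
    by (auto simp: Met_TC.mbounded_def bounded_subset_cball subset_iff)
qed

definition supnorm :: "'a set \<Rightarrow> ('a \<Rightarrow> real) \<Rightarrow> real" where
  "supnorm S z = (SUP x\<in>S. \<bar>z x\<bar>)"

definition maxnorm :: "'a set \<Rightarrow> ('a \<Rightarrow> real^'n) \<Rightarrow> real" where
  "maxnorm S u = Max (range (\<lambda>i. supnorm S (\<lambda>x. u x $ i)))"

definition P_on :: "'a::topological_space set \<Rightarrow> (real^'n) set \<Rightarrow> ('a \<Rightarrow> real^'n) set" where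
  "P_on S I = {u \<in> mspace (cfun S). \<forall>x\<in>S. u x \<in> I}"

subsection \<open>Hoelder classes\<close>

text \<open>Derivatives are taken within the closed set \<open>S\<close> under consideration (the closure of a domain
  with \<open>C\<^sup>1\<close> boundary, or a closed ball). At interior points these are the ordinary derivatives; at
  boundary points of such \<open>S\<close> the derivative within \<open>S\<close> is unique and, for functions of class
  \<open>C\<^sup>k\<close> up to the boundary, is the continuous extension of the interior derivative.\<close>

definition dir_deriv :: "(real^'m) set \<Rightarrow> (real^'m \<Rightarrow> real) \<Rightarrow> real^'m \<Rightarrow> real^'m \<Rightarrow> real" where
  "dir_deriv S u v x = frechet_derivative u (at x within S) v"

definition pderiv_on :: "(real^'m) set \<Rightarrow> 'm \<Rightarrow> (real^'m \<Rightarrow> real) \<Rightarrow> real^'m \<Rightarrow> real" where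
  "pderiv_on S j u = dir_deriv S u (axis j 1)"

definition holder_on :: "real \<Rightarrow> (real^'m) set \<Rightarrow> (real^'m \<Rightarrow> real) \<Rightarrow> bool" where
  "holder_on \<mu> S u \<longleftrightarrow> (\<exists>C. \<forall>x\<in>S. \<forall>y\<in>S. \<bar>u x - u y\<bar> \<le> C * dist x y powr \<mu>)"

text \<open>\<open>Ck_holder k \<mu> S u\<close>: \<open>u\<close> is of class \<open>C\<^sup>k\<close> on \<open>S\<close> and all partial derivatives of order
  \<open>k\<close> are \<open>\<mu>\<close>-Hoelder continuous on \<open>S\<close>.\<close>

primrec Ck_holder :: "nat \<Rightarrow> real \<Rightarrow> (real^'m) set \<Rightarrow> (real^'m \<Rightarrow> real) \<Rightarrow> bool" where
  "Ck_holder 0 \<mu> S u \<longleftrightarrow> holder_on \<mu> S u"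
| "Ck_holder (Suc k) \<mu> S u \<longleftrightarrow>
     u differentiable_on S \<and> (\<forall>j. Ck_holder k \<mu> S (pderiv_on S j u))"

subsection \<open>The boundary\<close>

text \<open>\<open>boundary_chart k \<mu> \<Omega> p r l g\<close>: inside the ball of radius \<open>r\<close> about \<open>p\<close>, the boundary of
  \<open>\<Omega>\<close> is the graph of the \<open>l\<close>-th coordinate as a \<open>C\<close>-\<open>(k+\<mu>)\<close> function \<open>g\<close> of the other
  coordinates, and \<open>\<Omega>\<close> is one of the two sides. A function of the other \<open>m - 1\<close> coordinates is
  encoded as a function on the whole space that does not depend on the \<open>l\<close>-th coordinate.\<close>

definition boundary_chart ::
  "nat \<Rightarrow> real \<Rightarrow> (real^'m) set \<Rightarrow> real^'m \<Rightarrow> real \<Rightarrow> 'm \<Rightarrow> (real^'m \<Rightarrow> real) \<Rightarrow> bool" where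
  "boundary_chart k \<mu> \<Omega> p r l g \<longleftrightarrow>
     0 < r \<and> (\<forall>x t. g (x + t *\<^sub>R axis l 1) = g x) \<and> Ck_holder k \<mu> (cball p r) g \<and>
     frontier \<Omega> \<inter> ball p r = {x \<in> ball p r. x $ l = g x} \<and>
     (\<Omega> \<inter> ball p r = {x \<in> ball p r. x $ l < g x} \<or> \<Omega> \<inter> ball p r = {x \<in> ball p r. x $ l > g x})"

definition Ck_holder_boundary :: "nat \<Rightarrow> real \<Rightarrow> (real^'m) set \<Rightarrow> bool" where
  "Ck_holder_boundary k \<mu> \<Omega> \<longleftrightarrow> (\<forall>p\<in>frontier \<Omega>. \<exists>r l g. boundary_chart k \<mu> \<Omega> p r l g)"

definition graph_point :: "'m \<Rightarrow> (real^'m \<Rightarrow> real) \<Rightarrow> real^'m \<Rightarrow> real^'m" where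
  "graph_point l g x = (\<chi> j. if j = l then g x else x $ j)"

text \<open>Functions of class \<open>C\<close>-\<open>(k+\<mu>)\<close>, \<open>k \<le> 2\<close>, on the boundary of a domain of class
  \<open>C\<close>-\<open>(2+\<mu>)\<close>: they are so in local coordinates. The smaller radius \<open>r'\<close> ensures that the
  parametrization stays on the boundary.\<close>

definition Ck_holder_on_boundary ::
  "nat \<Rightarrow> real \<Rightarrow> (real^'m) set \<Rightarrow> (real^'m \<Rightarrow> real) \<Rightarrow> bool" where
  "Ck_holder_on_boundary k \<mu> \<Omega> \<phi> \<longleftrightarrow>
     (\<forall>p\<in>frontier \<Omega>. \<exists>r l g r'. boundary_chart 2 \<mu> \<Omega> p r l g \<and> 0 < r' \<and> r' \<le> r \<and>
        graph_point l g ` cball p r' \<subseteq> frontier \<Omega> \<inter> ball p r \<and>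
        Ck_holder k \<mu> (cball p r') (\<phi> \<circ> graph_point l g))"

definition tangent_at :: "(real^'m) set \<Rightarrow> real^'m \<Rightarrow> real^'m \<Rightarrow> bool" where
  "tangent_at M p v \<longleftrightarrow>
     (\<exists>c \<epsilon>. 0 < \<epsilon> \<and> c 0 = p \<and> (\<forall>t\<in>{-\<epsilon><..<\<epsilon>}. c t \<in> M) \<and> (c has_vector_derivative v) (at (0::real)))"

definition outward_at :: "(real^'m) set \<Rightarrow> real^'m \<Rightarrow> real^'m \<Rightarrow> bool" where
  "outward_at \<Omega> p v \<longleftrightarrow> (\<exists>\<epsilon>>0. \<forall>t\<in>{0<..<\<epsilon>}. p + t *\<^sub>R v \<notin> closure \<Omega>)"

subsection \<open>Differential and boundary operators, solution operators\<close>

definition elliptic_op ::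
  "(real^'m) set \<Rightarrow> ('m \<Rightarrow> 'm \<Rightarrow> real^'m \<Rightarrow> real) \<Rightarrow> ('m \<Rightarrow> real^'m \<Rightarrow> real) \<Rightarrow> (real^'m \<Rightarrow> real) \<Rightarrow>
   (real^'m \<Rightarrow> real) \<Rightarrow> real^'m \<Rightarrow> real" where
  "elliptic_op \<Omega> a2 a1 a0 u x =
     - (\<Sum>j\<in>UNIV. \<Sum>l\<in>UNIV. a2 j l x * pderiv_on (closure \<Omega>) j (pderiv_on (closure \<Omega>) l u) x)
     + (\<Sum>j\<in>UNIV. a1 j x * pderiv_on (closure \<Omega>) j u x) + a0 x * u x"

definition boundary_op ::
  "(real^'m) set \<Rightarrow> (real^'m \<Rightarrow> real^'m) \<Rightarrow> (real^'m \<Rightarrow> real) \<Rightarrow> nat \<Rightarrow> (real^'m \<Rightarrow> real) \<Rightarrow> real^'m \<Rightarrow> real" where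
  "boundary_op \<Omega> \<nu> b \<delta> u x = b x * u x + real \<delta> * dir_deriv (closure \<Omega>) u (\<nu> x) x"

definition classical_solution ::
  "(real^'m) set \<Rightarrow> real \<Rightarrow> ((real^'m \<Rightarrow> real) \<Rightarrow> real^'m \<Rightarrow> real) \<Rightarrow> ((real^'m \<Rightarrow> real) \<Rightarrow> real^'m \<Rightarrow> real) \<Rightarrow>
   (real^'m \<Rightarrow> real) \<Rightarrow> (real^'m \<Rightarrow> real) \<Rightarrow> (real^'m \<Rightarrow> real) \<Rightarrow> bool" where
  "classical_solution \<Omega> \<mu> L B g \<zeta> u \<longleftrightarrow>
     u \<in> mspace (cfun (closure \<Omega>)) \<and> Ck_holder 2 \<mu> (closure \<Omega>) u \<and>
     (\<forall>x\<in>\<Omega>. L u x = g x) \<and> (\<forall>x\<in>frontier \<Omega>. B u x = \<zeta> x)"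

definition unique_classical_solution ::
  "(real^'m) set \<Rightarrow> real \<Rightarrow> ((real^'m \<Rightarrow> real) \<Rightarrow> real^'m \<Rightarrow> real) \<Rightarrow> ((real^'m \<Rightarrow> real) \<Rightarrow> real^'m \<Rightarrow> real) \<Rightarrow>
   (real^'m \<Rightarrow> real) \<Rightarrow> (real^'m \<Rightarrow> real) \<Rightarrow> (real^'m \<Rightarrow> real) \<Rightarrow> bool" where
  "unique_classical_solution \<Omega> \<mu> L B g \<zeta> u \<longleftrightarrow>
     classical_solution \<Omega> \<mu> L B g \<zeta> u \<and> (\<forall>v. classical_solution \<Omega> \<mu> L B g \<zeta> v \<longrightarrow> v = u)"

definition linear_cfun :: "'a::topological_space set \<Rightarrow> (('a \<Rightarrow> real) \<Rightarrow> 'a \<Rightarrow> real) \<Rightarrow> bool" where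
  "linear_cfun S K \<longleftrightarrow>
     (\<forall>f\<in>mspace (cfun S). \<forall>g\<in>mspace (cfun S). \<forall>c d.
        K (\<lambda>x\<in>S. c * f x + d * g x) = (\<lambda>x\<in>S. c * K f x + d * K g x))"

definition compact_cfun :: "'a::topological_space set \<Rightarrow> (('a \<Rightarrow> real) \<Rightarrow> 'a \<Rightarrow> real) \<Rightarrow> bool" where
  "compact_cfun S K \<longleftrightarrow>
     (let T = mtopology_of (cfun S :: ('a \<Rightarrow> real) metric)
      in compactin T (T closure_of (K ` {f \<in> mspace (cfun S). supnorm S f \<le> 1})))"

text \<open>The solution operator for homogeneous boundary data: the (unique) continuous linear compact
  extension to the continuous functions of the classical solution operator on Hoelder continuous
  right-hand sides; it preserves nonnegativity. Existence of this operator is a standard consequence of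
  Schauder theory and the maximum principle.\<close>

definition solution_operator ::
  "(real^'m) set \<Rightarrow> real \<Rightarrow> ((real^'m \<Rightarrow> real) \<Rightarrow> real^'m \<Rightarrow> real) \<Rightarrow> ((real^'m \<Rightarrow> real) \<Rightarrow> real^'m \<Rightarrow> real) \<Rightarrow>
   ((real^'m \<Rightarrow> real) \<Rightarrow> real^'m \<Rightarrow> real) \<Rightarrow> bool" where
  "solution_operator \<Omega> \<mu> L B K \<longleftrightarrow>
     linear_cfun (closure \<Omega>) K \<and>
     continuous_map (mtopology_of (cfun (closure \<Omega>))) (mtopology_of (cfun (closure \<Omega>))) K \<and>
     compact_cfun (closure \<Omega>) K \<and>
     (\<forall>f\<in>mspace (cfun (closure \<Omega>)). (\<forall>x\<in>closure \<Omega>. 0 \<le> f x) \<longrightarrow> (\<forall>x\<in>closure \<Omega>. 0 \<le> K f x)) \<and>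
     (\<forall>g\<in>mspace (cfun (closure \<Omega>)). Ck_holder 0 \<mu> (closure \<Omega>) g \<longrightarrow>
        unique_classical_solution \<Omega> \<mu> L B g (\<lambda>x. 0) (K g))"

subsection \<open>Weak solutions of the system\<close>

definition superposition ::
  "'a set \<Rightarrow> ('a \<Rightarrow> real^'n \<Rightarrow> real \<Rightarrow> real) \<Rightarrow> (('a \<Rightarrow> real^'n) \<Rightarrow> real) \<Rightarrow> ('a \<Rightarrow> real^'n) \<Rightarrow> 'a \<Rightarrow> real" where
  "superposition S f w u = (\<lambda>x\<in>S. f x (u x) (w u))"

definition weak_solution ::
  "'a::topological_space set \<Rightarrow> (real^'n) set \<Rightarrow> ('n \<Rightarrow> real) \<Rightarrow> ('n \<Rightarrow> real) \<Rightarrow>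
   ('n \<Rightarrow> ('a \<Rightarrow> real) \<Rightarrow> 'a \<Rightarrow> real) \<Rightarrow> ('n \<Rightarrow> 'a \<Rightarrow> real) \<Rightarrow>
   ('n \<Rightarrow> 'a \<Rightarrow> real^'n \<Rightarrow> real \<Rightarrow> real) \<Rightarrow> ('n \<Rightarrow> ('a \<Rightarrow> real^'n) \<Rightarrow> real) \<Rightarrow>
   ('n \<Rightarrow> ('a \<Rightarrow> real^'n) \<Rightarrow> real) \<Rightarrow> ('a \<Rightarrow> real^'n) \<Rightarrow> bool" where
  "weak_solution S I lam \<eta> K \<gamma> f w h u \<longleftrightarrow>
     u \<in> P_on S I \<and>
     (\<forall>i. \<forall>x\<in>S. u x $ i = lam i * K i (superposition S (f i) (w i) u) x + \<eta> i * h i u * \<gamma> i x)"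

end

theory Submission
  imports Defs
begin

text \<open>Choose \<open>i\<close> with \<open>\<parallel>u\<^sub>i\<parallel> = \<parallel>u\<parallel> = M\<close>. Then \<open>0 \<le> F\<^sub>i(u) \<le> \<tau>\<^sub>i M\<close>, and monotonicity of \<open>K\<^sub>i\<close> gives
  \<open>\<parallel>K\<^sub>i F\<^sub>i(u)\<parallel> \<le> \<tau>\<^sub>i M \<parallel>K\<^sub>i(1)\<parallel>\<close>. Taking norms in the \<open>i\<close>-th fixed point equation yields
  \<open>M \<le> (\<lambda>\<^sub>i \<tau>\<^sub>i \<parallel>K\<^sub>i(1)\<parallel> + \<eta>\<^sub>i \<theta>\<^sub>i \<parallel>\<gamma>\<^sub>i\<parallel>) M\<close>, hence \<open>M = 0\<close>.\<close>

text \<open>Compactness makes the image of \<open>\<bar>z x\<bar>\<close> bounded, so the supremum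
  in \<open>supnorm\<close> is a true upper bound; over an unbounded set of reals \<open>SUP\<close>
  would carry no information.\<close>

lemma abs_le_supnorm:
  assumes "compact S" "continuous_on S z" "x \<in> S"
  shows "\<bar>z x\<bar> \<le> supnorm S z"
proof -
  have "compact ((\<lambda>x. \<bar>z x\<bar>) ` S)"
    using assms by (intro compact_continuous_image continuous_intros)
  then have "bdd_above ((\<lambda>x. \<bar>z x\<bar>) ` S)"
    by (intro bounded_imp_bdd_above compact_imp_bounded)
  with assms(3) show ?thesis
    unfolding supnorm_def by (rule cSUP_upper)
qed

lemma supnorm_le:
  assumes "S \<noteq> {}" "\<And>x. x \<in> S \<Longrightarrow> \<bar>z x\<bar> \<le> c"
  shows "supnorm S z \<le> c"
  unfolding supnorm_def using assms by (rule cSUP_least)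

lemma supnorm_le_maxnorm: "supnorm S (\<lambda>x. u x $ i) \<le> maxnorm S (u :: 'a \<Rightarrow> real^'n::finite)"
  unfolding maxnorm_def by (rule Max_ge) auto

lemma maxnorm_attained:
  obtains i where "maxnorm S (u :: 'a \<Rightarrow> real^'n::finite) = supnorm S (\<lambda>x. u x $ i)"
proof -
  have "maxnorm S u \<in> range (\<lambda>i. supnorm S (\<lambda>x. u x $ i))"
    unfolding maxnorm_def by (rule Max_in) auto
  with that show ?thesis by blast
qed

lemma abs_component_le_maxnorm:
  fixes u :: "'a::topological_space \<Rightarrow> real^'n::finite"
  assumes "compact S" "continuous_on S u" "x \<in> S"
  shows "\<bar>u x $ i\<bar> \<le> maxnorm S u"
proof -
  have "\<bar>u x $ i\<bar> \<le> supnorm S (\<lambda>x. u x $ i)"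
    using assms by (intro abs_le_supnorm continuous_intros)
  also have "\<dots> \<le> maxnorm S u"
    by (rule supnorm_le_maxnorm)
  finally show ?thesis .
qed

text \<open>A positive linear operator is controlled by its value at the constant 1: applying
  \<open>K\<close> to \<open>c - g \<ge> 0\<close> gives \<open>K g \<le> c * K 1\<close> pointwise,
  while \<open>g \<ge> 0\<close> gives \<open>K g \<ge> 0\<close>, so the upper bound also bounds
  the absolute value.\<close>

lemma positive_operator_bound:
  fixes g :: "'a::topological_space \<Rightarrow> real"
  assumes S: "compact S"
    and lin: "linear_cfun S K"
    and maps: "K \<in> mspace (cfun S) \<rightarrow> mspace (cfun S)"
    and pos: "\<And>f. f \<in> mspace (cfun S) \<Longrightarrow> (\<And>x. x \<in> S \<Longrightarrow> 0 \<le> f x) \<Longrightarrow> (\<And>x. x \<in> S \<Longrightarrow> 0 \<le> K f x)"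
    and g: "g \<in> mspace (cfun S)" "\<And>x. x \<in> S \<Longrightarrow> 0 \<le> g x" "\<And>x. x \<in> S \<Longrightarrow> g x \<le> c"
    and c: "0 \<le> c"
    and x: "x \<in> S"
  shows "\<bar>K g x\<bar> \<le> c * supnorm S (K (\<lambda>x\<in>S. 1))"
proof -
  let ?one = "\<lambda>x\<in>S. 1::real"
  \<comment> \<open>The function \<open>c - g\<close>, with coefficients \<open>c\<close> and
    \<open>-1\<close> so that it has the shape of \<open>linear_cfun\<close>; the restriction to
    \<open>S\<close> makes it extensional.\<close>
  let ?d = "\<lambda>x\<in>S. c * ?one x + (-1) * g x"
  have one: "?one \<in> mspace (cfun S)"
    by (simp only: mspace_cfun_iff[OF S]) (simp cong: continuous_on_cong)
  have contg: "continuous_on S g"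
    using g(1) by (simp only: mspace_cfun_iff[OF S])
  then have "continuous_on S (\<lambda>x. c * 1 + (-1) * g x)"
    by (intro continuous_intros)
  then have "continuous_on S ?d"
    by (rule continuous_on_eq) simp
  then have d: "?d \<in> mspace (cfun S)"
    by (simp only: mspace_cfun_iff[OF S] restrict_extensional simp_thms)
  have "K ?d = (\<lambda>x\<in>S. c * K ?one x + (-1) * K g x)"
    using lin one g(1) unfolding linear_cfun_def by blast
  moreover have "0 \<le> K ?d x"
    using d _ x by (rule pos) (simp add: g(3))
  ultimately have upper: "K g x \<le> c * K ?one x"
    using x by simp
  have "K ?one \<in> mspace (cfun S)"
    using maps one by blast
  then have "continuous_on S (K ?one)"
    by (simp only: mspace_cfun_iff[OF S])
  then have "\<bar>K ?one x\<bar> \<le> supnorm S (K ?one)"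
    using S x by (intro abs_le_supnorm)
  then have "c * K ?one x \<le> c * supnorm S (K ?one)"
    using c by (intro mult_left_mono) auto
  moreover have "0 \<le> K g x"
    using g(1,2) x by (rule pos)
  ultimately show ?thesis
    using upper by simp
qed

text \<open>For fixed \<open>u\<close> the nonlocal term \<open>w u\<close> is a single number, so
  the superposition is \<open>f\<close> composed with the continuous map
  \<open>x \<mapsto> (x, u x, w u)\<close> into \<open>S \<times> I \<times> W\<close>.\<close>

lemma superposition_in_cfun:
  assumes S: "compact S"
    and u: "continuous_on S u" "\<And>x. x \<in> S \<Longrightarrow> u x \<in> I"
    and w: "w u \<in> W"
    and f: "continuous_on (S \<times> I \<times> W) (\<lambda>(x, y, s). f x y s)"
  shows "superposition S f w u \<in> mspace (cfun S)"
proof -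
  have "continuous_on S ((\<lambda>(x, y, s). f x y s) \<circ> (\<lambda>x. (x, u x, w u)))"
  proof (rule continuous_on_compose)
    show "continuous_on S (\<lambda>x. (x, u x, w u))"
      using u(1) by (intro continuous_intros)
    show "continuous_on ((\<lambda>x. (x, u x, w u)) ` S) (\<lambda>(x, y, s). f x y s)"
      using u(2) w by (intro continuous_on_subset[OF f]) auto
  qed
  then have "continuous_on S (superposition S f w u)"
    by (rule continuous_on_eq) (simp add: superposition_def)
  then show ?thesis
    by (simp only: mspace_cfun_iff[OF S] simp_thms) (simp add: superposition_def)
qed

theorem theorem2p4:
  fixes \<Omega> :: "(real^'m) set" and \<mu> :: real and \<nu> :: "real^'m \<Rightarrow> real^'m"
    and a2 :: "'n::finite \<Rightarrow> 'm \<Rightarrow> 'm \<Rightarrow> real^'m \<Rightarrow> real"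
    and a1 :: "'n \<Rightarrow> 'm \<Rightarrow> real^'m \<Rightarrow> real"
    and a0 b \<zeta> \<gamma> :: "'n \<Rightarrow> real^'m \<Rightarrow> real"
    and \<delta> :: "'n \<Rightarrow> nat"
    and L B K :: "'n \<Rightarrow> (real^'m \<Rightarrow> real) \<Rightarrow> real^'m \<Rightarrow> real"
    and lam \<eta> \<tau> \<theta> :: "'n \<Rightarrow> real"
    and \<rho> :: "real^'n" and I :: "(real^'n) set"
    and f :: "'n \<Rightarrow> real^'m \<Rightarrow> real^'n \<Rightarrow> real \<Rightarrow> real"
    and w h :: "'n \<Rightarrow> (real^'m \<Rightarrow> real^'n) \<Rightarrow> real"
  assumes dim: "CARD('m) \<ge> 2"
    and mu: "0 < \<mu>" "\<mu> < 1"
    and domain: "open \<Omega>" "connected \<Omega>" "bounded \<Omega>" "\<Omega> \<noteq> {}" "Ck_holder_boundary 2 \<mu> \<Omega>"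
    and nu_regular: "\<And>j. Ck_holder_on_boundary 1 \<mu> \<Omega> (\<lambda>x. \<nu> x $ j)"
    and nu_outward: "\<And>x. x \<in> frontier \<Omega> \<Longrightarrow> outward_at \<Omega> x (\<nu> x)"
    and nu_not_tangent: "\<And>x. x \<in> frontier \<Omega> \<Longrightarrow> \<not> tangent_at (frontier \<Omega>) x (\<nu> x)"
    and coeff_regular: "\<And>i j l. Ck_holder 0 \<mu> (closure \<Omega>) (a2 i j l)"
      "\<And>i j. Ck_holder 0 \<mu> (closure \<Omega>) (a1 i j)" "\<And>i. Ck_holder 0 \<mu> (closure \<Omega>) (a0 i)"
    and a0_nonneg: "\<And>i x. x \<in> closure \<Omega> \<Longrightarrow> 0 \<le> a0 i x"
    and a2_sym: "\<And>i j l x. x \<in> closure \<Omega> \<Longrightarrow> a2 i j l x = a2 i l j x"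
    and elliptic: "\<And>i. \<exists>\<mu>0>0. \<forall>x\<in>\<Omega>. \<forall>\<xi>::real^'m.
      (\<Sum>j\<in>UNIV. \<Sum>l\<in>UNIV. a2 i j l x * \<xi> $ j * \<xi> $ l) \<ge> \<mu>0 * (norm \<xi>)\<^sup>2"
    and L_def: "\<And>i. L i = elliptic_op \<Omega> (a2 i) (a1 i) (a0 i)"
    and b_regular: "\<And>i. Ck_holder_on_boundary 1 \<mu> \<Omega> (b i)"
    and boundary_conditions: "\<And>i.
      (\<delta> i = 0 \<and> (\<forall>x\<in>frontier \<Omega>. b i x = 1)) \<or>
      (\<delta> i = 1 \<and> (\<forall>x\<in>frontier \<Omega>. b i x = 0) \<and> (\<exists>x\<in>closure \<Omega>. a0 i x \<noteq> 0)) \<or>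
      (\<delta> i = 1 \<and> (\<forall>x\<in>frontier \<Omega>. b i x \<ge> 0) \<and> (\<exists>x\<in>frontier \<Omega>. b i x \<noteq> 0))"
    and B_def: "\<And>i. B i = boundary_op \<Omega> \<nu> (b i) (\<delta> i)"
    and K: "\<And>i. solution_operator \<Omega> \<mu> (L i) (B i) (K i)"
    and zeta: "\<And>i. Ck_holder_on_boundary (2 - \<delta> i) \<mu> \<Omega> (\<zeta> i)"
      "\<And>i x. x \<in> frontier \<Omega> \<Longrightarrow> 0 \<le> \<zeta> i x"
    and gamma: "\<And>i. unique_classical_solution \<Omega> \<mu> (L i) (B i) (\<lambda>x. 0) (\<zeta> i) (\<gamma> i)"
    and params: "\<And>i. 0 \<le> lam i" "\<And>i. 0 \<le> \<eta> i"
    and rho: "\<And>i. 0 < \<rho> $ i"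
    and I_def: "I = {y. \<forall>i. 0 \<le> y $ i \<and> y $ i \<le> \<rho> $ i}"
    and w_cont: "\<And>i. continuous_map
      (subtopology (mtopology_of (cfun (closure \<Omega>))) (P_on (closure \<Omega>) I)) euclideanreal (w i)"
    and w_bounded: "\<And>i. bdd_below (w i ` P_on (closure \<Omega>) I)"
      "\<And>i. bdd_above (w i ` P_on (closure \<Omega>) I)"
    and f_cont: "\<And>i. continuous_on
      (closure \<Omega> \<times> I \<times> {(INF u\<in>P_on (closure \<Omega>) I. w i u)..(SUP u\<in>P_on (closure \<Omega>) I. w i u)})
      (\<lambda>(x, y, s). f i x y s)"
    and tau: "\<And>i. 0 < \<tau> i"
      "\<And>i x y s. x \<in> closure \<Omega> \<Longrightarrow> y \<in> I \<Longrightarrow>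
         s \<in> {(INF u\<in>P_on (closure \<Omega>) I. w i u)..(SUP u\<in>P_on (closure \<Omega>) I. w i u)} \<Longrightarrow>
         0 \<le> f i x y s \<and> f i x y s \<le> \<tau> i * y $ i"
    and h_cont: "\<And>i. continuous_map
      (subtopology (mtopology_of (cfun (closure \<Omega>))) (P_on (closure \<Omega>) I)) euclideanreal (h i)"
    and h_nonneg: "\<And>i u. u \<in> P_on (closure \<Omega>) I \<Longrightarrow> 0 \<le> h i u"
    and theta: "\<And>i. 0 < \<theta> i"
      "\<And>i u. u \<in> P_on (closure \<Omega>) I \<Longrightarrow> h i u \<le> \<theta> i * maxnorm (closure \<Omega>) u"
    and small: "\<And>i. lam i * \<tau> i * supnorm (closure \<Omega>) (K i (\<lambda>x\<in>closure \<Omega>. 1))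
      + \<eta> i * \<theta> i * supnorm (closure \<Omega>) (\<gamma> i) < 1"
  shows "\<not> (\<exists>u \<in> P_on (closure \<Omega>) I - {\<lambda>x\<in>closure \<Omega>. 0}.
      weak_solution (closure \<Omega>) I lam \<eta> K \<gamma> f w h u)"
proof
  let ?S = "closure \<Omega>"
  assume "\<exists>u \<in> P_on ?S I - {\<lambda>x\<in>?S. 0}. weak_solution ?S I lam \<eta> K \<gamma> f w h u"
  then obtain u where uP: "u \<in> P_on ?S I" and nz: "u \<noteq> (\<lambda>x\<in>?S. 0)"
    and sol: "weak_solution ?S I lam \<eta> K \<gamma> f w h u"
    by blast
  have S: "compact ?S" and ne: "?S \<noteq> {}"
    using domain by (simp_all add: compact_closure)
  have u_cfun: "u \<in> mspace (cfun ?S)" and uI: "\<And>x. x \<in> ?S \<Longrightarrow> u x \<in> I"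
    using uP by (auto simp: P_on_def)
  have u_ext: "u \<in> extensional ?S" and u_cont: "continuous_on ?S u"
    using u_cfun by (simp_all only: mspace_cfun_iff[OF S])
  define M where "M = maxnorm ?S u"
  have comp: "\<bar>u x $ i\<bar> \<le> M" if "x \<in> ?S" for x i
    unfolding M_def using S u_cont that by (rule abs_component_le_maxnorm)
  \<comment> \<open>If \<open>M\<close> were not positive, all components of \<open>u\<close> would
    vanish on the closure, and extensionality would identify \<open>u\<close> with the excluded zero
    function. Strict positivity is what later turns the smallness condition into a strict
    inequality.\<close>
  have Mpos: "0 < M"
  proof (rule ccontr)
    assume "\<not> 0 < M"
    then have "u x = 0" if "x \<in> ?S" for x
      using comp[OF that] by (simp add: vec_eq_iff) (meson abs_le_zero_iff not_less order_trans)
    then have "u = (\<lambda>x\<in>?S. 0)"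
      by (intro extensionalityI[OF u_ext]) auto
    with nz show False by blast
  qed
  \<comment> \<open>The maximum over the finite index type is attained; from here on only this one
    equation of the system is used.\<close>
  obtain i where i: "M = supnorm ?S (\<lambda>x. u x $ i)"
    unfolding M_def by (rule maxnorm_attained)
  let ?F = "superposition ?S (f i) (w i) u"
  let ?W = "{(INF v\<in>P_on ?S I. w i v)..(SUP v\<in>P_on ?S I. w i v)}"
  let ?k = "supnorm ?S (K i (\<lambda>x\<in>?S. 1))"
  let ?g = "supnorm ?S (\<gamma> i)"
  \<comment> \<open>Boundedness of the range of \<open>w i\<close> makes \<open>INF\<close> and
    \<open>SUP\<close> genuine bounds, so the hypotheses on \<open>f i\<close> apply at
    \<open>s = w i u\<close>.\<close>
  have wW: "w i u \<in> ?W"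
    using uP w_bounded by (auto intro: cINF_lower cSUP_upper)
  have F_cfun: "?F \<in> mspace (cfun ?S)"
    using S u_cont uI wW f_cont by (rule superposition_in_cfun)
  \<comment> \<open>The growth condition gives \<open>f i \<le> \<tau> i * u x $ i\<close>, and
    every component of \<open>u\<close> is at most \<open>M\<close>.\<close>
  have F_nonneg: "0 \<le> ?F x" and F_le: "?F x \<le> \<tau> i * M" if "x \<in> ?S" for x
  proof -
    have "\<tau> i * u x $ i \<le> \<tau> i * M"
      using comp[OF that, of i] tau(1)[of i] by (intro mult_left_mono) auto
    with tau(2)[OF that uI[OF that] wW] that show "0 \<le> ?F x" "?F x \<le> \<tau> i * M"
      by (auto simp: superposition_def)
  qed
  \<comment> \<open>That \<open>K i\<close> maps the function space into itself is read off from its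
    continuity between the metric topologies.\<close>
  have K_lin: "linear_cfun ?S (K i)"
    and K_maps: "K i \<in> mspace (cfun ?S) \<rightarrow> mspace (cfun ?S)"
    and K_pos: "\<And>f x. f \<in> mspace (cfun ?S) \<Longrightarrow> (\<And>x. x \<in> ?S \<Longrightarrow> 0 \<le> f x) \<Longrightarrow> x \<in> ?S \<Longrightarrow> 0 \<le> K i f x"
    using K[of i] continuous_map_funspace[of "mtopology_of (cfun ?S)" "mtopology_of (cfun ?S)" "K i"]
    unfolding solution_operator_def topspace_mtopology_of by blast+
  have "\<gamma> i \<in> mspace (cfun ?S)"
    using gamma[of i] unfolding unique_classical_solution_def classical_solution_def by blast
  then have gamma_cont: "continuous_on ?S (\<gamma> i)"
    by (simp only: mspace_cfun_iff[OF S])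
  have h_le: "h i u \<le> \<theta> i * M"
    unfolding M_def using uP by (rule theta(2))
  \<comment> \<open>A bound uniform in \<open>x\<close>: the operator term is estimated by
    positivity with \<open>c = \<tau> i * M\<close>, the boundary term by
    \<open>h i u \<le> \<theta> i * M\<close> and the sup norm of \<open>\<gamma> i\<close>.\<close>
  have "\<bar>u x $ i\<bar> \<le> (lam i * \<tau> i * ?k + \<eta> i * \<theta> i * ?g) * M" if x: "x \<in> ?S" for x
  proof -
    have "\<bar>K i ?F x\<bar> \<le> \<tau> i * M * ?k"
      using tau(1)[of i] Mpos
      by (intro positive_operator_bound[OF S K_lin K_maps K_pos F_cfun F_nonneg F_le _ x]) auto
    then have "lam i * \<bar>K i ?F x\<bar> \<le> lam i * (\<tau> i * M * ?k)"
      using params(1) by (rule mult_left_mono)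
    moreover have "h i u * \<bar>\<gamma> i x\<bar> \<le> \<theta> i * M * ?g"
      using h_le h_nonneg[OF uP, of i] abs_le_supnorm[OF S gamma_cont x]
      by (intro mult_mono') auto
    then have "\<eta> i * (h i u * \<bar>\<gamma> i x\<bar>) \<le> \<eta> i * (\<theta> i * M * ?g)"
      using params(2) by (rule mult_left_mono)
    moreover have "u x $ i = lam i * K i ?F x + \<eta> i * h i u * \<gamma> i x"
      using sol x unfolding weak_solution_def by blast
    then have "\<bar>u x $ i\<bar> \<le> lam i * \<bar>K i ?F x\<bar> + \<eta> i * (h i u * \<bar>\<gamma> i x\<bar>)"
      using abs_triangle_ineq[of "lam i * K i ?F x" "\<eta> i * h i u * \<gamma> i x"]
        params[of i] h_nonneg[OF uP, of i] by (simp add: abs_mult mult.assoc)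
    ultimately show ?thesis
      by (simp add: algebra_simps)
  qed
  then have "supnorm ?S (\<lambda>x. u x $ i) \<le> (lam i * \<tau> i * ?k + \<eta> i * \<theta> i * ?g) * M"
    by (intro supnorm_le[OF ne])
  \<comment> \<open>The choice of \<open>i\<close> makes the left-hand supremum equal to
    \<open>M\<close>, so \<open>M\<close> is bounded by a factor less than 1 times itself, which is
    impossible for \<open>M > 0\<close>.\<close>
  then have "M \<le> (lam i * \<tau> i * ?k + \<eta> i * \<theta> i * ?g) * M"
    unfolding i[symmetric] .
  also have "\<dots> < 1 * M"
    using small Mpos by (rule mult_strict_right_mono)
  finally show False by simp
qed

end
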